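(* Let $m\ge 1$ be an integer and let $(A_k)_{1\le k\le N}$ be a finite sequence of $m$-dependent events on a probability space with probability measure $\mathbb{P}$. Write $$S_N=\sum_{k=1}^{N}\mathbb{P}(A_k).$$ Then $$\mathbb{P}\Bigl(\bigcup_{k=1}^N A_k\Bigr)\ \ge\ 1-\exp\Bigl(-\frac{1}{m+1}\,S_N\Bigr).$$
   Context: For finite index sets $I,J\subseteq\mathbb{N}$, put $\mathrm{dist}(I,J)=\inf\{|i-j| : i\in I,\ j\in J\}$. A sequence of events $(A_k)$ on a probability space is called $m$-dependent if, whenever $I,J$ are finite sets of indices of the sequence with $\mathrm{dist}(I,J)>m$, the sigma-algebras generated by $\{A_i : i\in I\}$ and by $\{A_j : j\in J\}$ are independent. For a finite sequence $(A_k)_{1\le k\le N}$, the index sets $I,J$ range over subsets of $\{1,\dots,N\}$. *)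

theory Defs
  imports "HOL-Probability.Probability" "HOL-Library.Extended_Nat"
begin

text \<open>The values are extended naturals, so that the infimum over an empty set of distances
  (that is, if one of the index sets is empty) is \<^term>\<open>\<infinity> :: enat\<close>.\<close>

definition index_dist :: "nat set \<Rightarrow> nat set \<Rightarrow> enat" where
  "index_dist I J = Inf {enat (nat \<bar>int i - int j\<bar>) | i j. i \<in> I \<and> j \<in> J}"

text \<open>The set \<open>K\<close> is the index set of the sequence; values of \<open>A\<close> outside \<open>K\<close> are irrelevant.\<close>

definition (in prob_space) m_dependent_events :: "nat \<Rightarrow> (nat \<Rightarrow> 'a set) \<Rightarrow> nat set \<Rightarrow> bool" where
  "m_dependent_events m A K \<longleftrightarrow>
     (\<forall>k\<in>K. A k \<in> events) \<and>
     (\<forall>I J. I \<subseteq> K \<longrightarrow> J \<subseteq> K \<longrightarrow> finite I \<longrightarrow> finite J \<longrightarrow> index_dist I J > enat m \<longrightarrow>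
        indep_set (sigma_sets (space M) (A ` I)) (sigma_sets (space M) (A ` J)))"

end

theory Submission
  imports Defs
begin

text \<open>Indices in one residue class modulo \<open>m + 1\<close> are pairwise more than \<open>m\<close> apart, so the
  events indexed by a single class are mutually independent, and the probability that all of
  them fail is the product of the factors \<open>1 - P(A\<^sub>k) \<le> exp (- P(A\<^sub>k))\<close>. There are \<open>m + 1\<close>
  classes, and together they carry the whole sum \<open>S\<^sub>N\<close>; hence some class carries at least
  \<open>S\<^sub>N / (m + 1)\<close>. The union over that class alone already has the required probability.
  The product formula is \<open>prob_none_of_spaced_events\<close>, and the choice of the class is
  \<open>residue_class_sum_ge_average\<close>.\<close>

lemma index_dist_singleton_gt:
  assumes "\<And>j. j \<in> J \<Longrightarrow> int m < \<bar>int i - int j\<bar>"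
  shows "enat m < index_dist {i} J"
proof -
  have "enat (Suc m) \<le> index_dist {i} J"
    unfolding index_dist_def
  proof (rule Inf_greatest, clarsimp)
    fix j assume "j \<in> J"
    from assms[OF this] show "Suc m \<le> nat \<bar>int i - int j\<bar>" by linarith
  qed
  then show ?thesis by (metis enat_ord_simps(2) lessI less_le_trans)
qed

lemma distinct_congruent_far_apart:
  fixes i j m :: nat
  assumes "i mod Suc m = j mod Suc m" "i \<noteq> j"
  shows "int m < \<bar>int i - int j\<bar>"
proof -
  have "int (Suc m) dvd int i - int j"
    using assms(1) by (metis mod_eq_dvd_iff zmod_int)
  then have "int (Suc m) \<le> \<bar>int i - int j\<bar>"
    using assms(2) by (intro zdvd_imp_le) auto
  then show ?thesis by simp
qed

text \<open>Adding one index \<open>x\<close> to a spaced set \<open>F\<close> uses the hypothesis only for the two index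
  sets \<open>{x}\<close> and \<open>F\<close>: the event that no \<open>A\<^sub>j\<close> with \<open>j \<in> F\<close> occurs lies in the
  sigma-algebra generated by \<open>F\<close>, so it is independent of the complement of \<open>A\<^sub>x\<close>.\<close>

lemma (in prob_space) prob_none_of_spaced_events:
  assumes dep: "m_dependent_events m A K"
    and "finite J" "J \<subseteq> K"
    and "\<And>i j. i \<in> J \<Longrightarrow> j \<in> J \<Longrightarrow> i \<noteq> j \<Longrightarrow> int m < \<bar>int i - int j\<bar>"
  shows "prob (space M - (\<Union>j\<in>J. A j)) = (\<Prod>j\<in>J. 1 - prob (A j))"
  using assms(2-)
proof (induction J rule: finite_induct)
  case empty
  then show ?case by (simp add: prob_space)
next
  case (insert x F)
  have ev: "A k \<in> events" if "k \<in> K" for k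
    using dep that by (auto simp: m_dependent_events_def)
  have "enat m < index_dist {x} F"
    using insert.hyps insert.prems(2) by (intro index_dist_singleton_gt) auto
  then have ind: "indep_set (sigma_sets (space M) (A ` {x})) (sigma_sets (space M) (A ` F))"
    using dep[unfolded m_dependent_events_def, THEN conjunct2, rule_format, of "{x}" F]
      insert.prems(1) insert.hyps(1) by simp
  have x_mem: "space M - A x \<in> sigma_sets (space M) (A ` {x})"
    by (intro sigma_sets.Compl sigma_sets.Basic) auto
  have F_mem: "space M - (\<Union>j\<in>F. A j) \<in> sigma_sets (space M) (A ` F)"
    using insert.hyps(1)
    by (intro sigma_sets.Compl sigma_sets_UNION) (auto intro: countable_finite)
  have "space M - (\<Union>j\<in>insert x F. A j) = (space M - A x) \<inter> (space M - (\<Union>j\<in>F. A j))"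
    by auto
  also have "prob \<dots> = prob (space M - A x) * prob (space M - (\<Union>j\<in>F. A j))"
    using indep_setD[OF ind x_mem F_mem] .
  also have "\<dots> = (1 - prob (A x)) * (\<Prod>j\<in>F. 1 - prob (A j))"
    using insert ev by (simp add: prob_compl)
  finally show ?case using insert.hyps by simp
qed

lemma residue_class_sum_ge_average:
  fixes f :: "nat \<Rightarrow> real"
  assumes "finite K"
  obtains r where "sum f K / (real m + 1) \<le> (\<Sum>k | k \<in> K \<and> k mod Suc m = r. f k)"
proof (rule ccontr)
  let ?T = "\<lambda>r. \<Sum>k | k \<in> K \<and> k mod Suc m = r. f k"
  assume "\<not> thesis"
  have "?T r < sum f K / (real m + 1)" for r
    using that[of r] \<open>\<not> thesis\<close> by (cases "?T r < sum f K / (real m + 1)") auto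
  then have "(\<Sum>r<Suc m. ?T r) < (\<Sum>r<Suc m. sum f K / (real m + 1))"
    by (intro sum_strict_mono) auto
  also have "\<dots> = sum f K" by (simp add: field_simps)
  also have "\<dots> = (\<Sum>r<Suc m. ?T r)"
    using assms by (intro sum.group[symmetric]) auto
  finally show False by simp
qed

theorem theorem2:
  fixes M :: "'a measure" and A :: "nat \<Rightarrow> 'a set" and m N :: nat
  assumes "prob_space M"
    and "m \<ge> 1"
    and "prob_space.m_dependent_events M m A {1..N}"
  shows "measure M (\<Union>k\<in>{1..N}. A k)
           \<ge> 1 - exp (- (1 / (real m + 1)) * (\<Sum>k=1..N. measure M (A k)))"
proof -
  interpret prob_space M by fact
  have ev: "A k \<in> events" if "k \<in> {1..N}" for k
    using assms(3) that by (auto simp: m_dependent_events_def)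
  obtain r where r: "(\<Sum>k=1..N. prob (A k)) / (real m + 1)
      \<le> (\<Sum>k | k \<in> {1..N} \<and> k mod Suc m = r. prob (A k))"
    using residue_class_sum_ge_average[of "{1..N}" "\<lambda>k. prob (A k)" m] by auto
  define J where "J = {k \<in> {1..N}. k mod Suc m = r}"
  have J: "finite J" "J \<subseteq> {1..N}" by (auto simp: J_def)
  have "1 - prob (\<Union>k\<in>J. A k) = prob (space M - (\<Union>k\<in>J. A k))"
    using J ev by (intro prob_compl[symmetric] sets.finite_UN) auto
  also have "\<dots> = (\<Prod>k\<in>J. 1 - prob (A k))"
    using J by (intro prob_none_of_spaced_events[OF assms(3)] distinct_congruent_far_apart)
      (auto simp: J_def)
  also have "\<dots> \<le> (\<Prod>k\<in>J. exp (- prob (A k)))"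
    using exp_ge_add_one_self[of "- prob (A k)" for k] by (intro prod_mono) auto
  also have "\<dots> = exp (- (\<Sum>k\<in>J. prob (A k)))"
    using J by (simp add: exp_sum sum_negf[symmetric])
  also have "\<dots> \<le> exp (- (1 / (real m + 1)) * (\<Sum>k=1..N. prob (A k)))"
    using r by (simp add: J_def)
  finally have "1 - exp (- (1 / (real m + 1)) * (\<Sum>k=1..N. prob (A k))) \<le> prob (\<Union>k\<in>J. A k)"
    by simp
  also have "\<dots> \<le> prob (\<Union>k\<in>{1..N}. A k)"
    using J ev by (intro finite_measure_mono UN_mono sets.finite_UN) auto
  finally show ?thesis .
qed

end
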